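(* Let $n\geq 5$. Every spherical thrackle drawing (in general position) of the $n$-cycle is good. Moreover, if $n$ is even, such a drawing contains at least one long edge.
   Context: A spherical thrackle drawing of a graph is a drawing on the unit sphere $S^2\subset\mathbb{R}^3$ in which vertices are points, every edge is an arc of a great circle (possibly of length greater than $\pi$), and every pair of distinct edges meets in exactly one point, which is either a common endpoint or a proper crossing. The drawing is assumed to be in general position: no two edges lie on the same great circle, and no edge has length exactly $\pi$. An edge is long if its length is greater than $\pi$ and short if its length is less than $\pi$. Crossing orientation: if $e,f$ are two distinct directed edges meeting at the point $p$ (a crossing or a common endpoint), let $u_e,u_f$ be the unit tangent vectors at $p$ of $e$ and $f$ pointing in their directions of travel (one-sided at an endpoint); then $\chi(e,f)=\operatorname{sign}\langle p, u_e\times u_f\rangle\in\{1,-1\}$ (well defined by general position); note $\chi(e,f)=-\chi(f,e)$. A directed path $e_1e_2\dots e_k$ (consecutive edges sharing the end of $e_{i-1}$ and the start of $e_i$) is good if either $\chi(e_{i-1},e_i)=1$ for all $i=2,\dots,k$ or $\chi(e_{i-1},e_i)=-1$ for all $i=2,\dots,k$, and bad otherwise. A cycle is good if every directed path contained in it (traversed in either direction) is good, and bad otherwise. *)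

theory Defs
  imports "HOL-Analysis.Analysis"
begin

text \<open>
  A directed great-circle arc is given by its starting point, its initial unit tangent vector and
  its length; it is traversed at unit speed.  Arcs of length greater than \<open>\<pi>\<close> are not determined
  by their endpoints, which is why the initial direction and the length are part of the data.
\<close>

datatype garc = GArc (src: "real^3") (dir0: "real^3") (len: real)

definition is_garc :: "garc \<Rightarrow> bool" where
  "is_garc a \<longleftrightarrow> norm (src a) = 1 \<and> norm (dir0 a) = 1 \<and> src a \<bullet> dir0 a = 0
     \<and> 0 < len a \<and> len a < 2 * pi"

definition arc_pt :: "garc \<Rightarrow> real \<Rightarrow> real^3" where
  "arc_pt a t = cos t *\<^sub>R src a + sin t *\<^sub>R dir0 a"

definition arc_vel :: "garc \<Rightarrow> real \<Rightarrow> real^3" where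
  "arc_vel a t = (- sin t) *\<^sub>R src a + cos t *\<^sub>R dir0 a"

definition tgt :: "garc \<Rightarrow> real^3" where
  "tgt a = arc_pt a (len a)"

definition arc_points :: "garc \<Rightarrow> (real^3) set" where
  "arc_points a = arc_pt a ` {0..len a}"

definition arc_interior :: "garc \<Rightarrow> (real^3) set" where
  "arc_interior a = arc_pt a ` {0<..<len a}"

definition great_circle :: "garc \<Rightarrow> (real^3) set" where
  "great_circle a = range (arc_pt a)"

definition arc_reverse :: "garc \<Rightarrow> garc" where
  "arc_reverse a = GArc (tgt a) (- arc_vel a (len a)) (len a)"

lemma arc_vel_derivative: "(arc_pt a has_vector_derivative arc_vel a t) (at t within S)"
  unfolding arc_pt_def arc_vel_def
  by (auto intro!: derivative_eq_intros simp: has_real_derivative_iff_has_vector_derivative [symmetric])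

lemma arc_pt_reverse: "arc_pt (arc_reverse a) t = arc_pt a (len a - t)"
  by (simp add: arc_pt_def arc_reverse_def tgt_def arc_vel_def cos_diff sin_diff algebra_simps)

text \<open>The parameter below is unique when the point lies on the arc, because \<open>len a < 2\<pi>\<close>.\<close>

definition tangent_at :: "garc \<Rightarrow> real^3 \<Rightarrow> real^3" where
  "tangent_at a p = arc_vel a (THE t. t \<in> {0..len a} \<and> arc_pt a t = p)"

definition meeting_point :: "garc \<Rightarrow> garc \<Rightarrow> real^3" where
  "meeting_point a b = (THE p. p \<in> arc_points a \<inter> arc_points b)"

definition chi :: "garc \<Rightarrow> garc \<Rightarrow> real" where
  "chi a b = (let p = meeting_point a b in sgn (p \<bullet> cross3 (tangent_at a p) (tangent_at b p)))"

definition proper_crossing :: "garc \<Rightarrow> garc \<Rightarrow> real^3 \<Rightarrow> bool" where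
  "proper_crossing a b p \<longleftrightarrow> p \<in> arc_interior a \<and> p \<in> arc_interior b
     \<and> cross3 (tangent_at a p) (tangent_at b p) \<noteq> 0"

text \<open>
  A graph has vertex set \<open>V\<close> and edge set \<open>E\<close>, each edge being a two-element set of vertices.
  In a drawing, \<open>A x y\<close> is the edge \<open>{x, y}\<close> directed from \<open>x\<close> to \<open>y\<close>.
\<close>

definition spherical_drawing ::
  "'v set \<Rightarrow> 'v set set \<Rightarrow> ('v \<Rightarrow> real^3) \<Rightarrow> ('v \<Rightarrow> 'v \<Rightarrow> garc) \<Rightarrow> bool" where
  "spherical_drawing V E pos A \<longleftrightarrow>
     inj_on pos V \<and> pos ` V \<subseteq> sphere 0 1 \<and>
     (\<forall>x y. {x, y} \<in> E \<longrightarrow>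
        is_garc (A x y) \<and> src (A x y) = pos x \<and> tgt (A x y) = pos y \<and>
        A y x = arc_reverse (A x y))"

definition spherical_thrackle ::
  "'v set \<Rightarrow> 'v set set \<Rightarrow> ('v \<Rightarrow> real^3) \<Rightarrow> ('v \<Rightarrow> 'v \<Rightarrow> garc) \<Rightarrow> bool" where
  "spherical_thrackle V E pos A \<longleftrightarrow>
     spherical_drawing V E pos A \<and>
     (\<forall>x y z w. {x, y} \<in> E \<and> {z, w} \<in> E \<and> {x, y} \<noteq> {z, w} \<longrightarrow>
        (\<exists>p. arc_points (A x y) \<inter> arc_points (A z w) = {p} \<and>
             (p \<in> pos ` ({x, y} \<inter> {z, w}) \<or> proper_crossing (A x y) (A z w) p)))"

definition general_position :: "'v set set \<Rightarrow> ('v \<Rightarrow> 'v \<Rightarrow> garc) \<Rightarrow> bool" where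
  "general_position E A \<longleftrightarrow>
     (\<forall>x y. {x, y} \<in> E \<longrightarrow> len (A x y) \<noteq> pi) \<and>
     (\<forall>x y z w. {x, y} \<in> E \<and> {z, w} \<in> E \<and> {x, y} \<noteq> {z, w} \<longrightarrow>
        great_circle (A x y) \<noteq> great_circle (A z w))"

definition long_arc :: "garc \<Rightarrow> bool" where
  "long_arc a \<longleftrightarrow> len a > pi"

text \<open>
  A directed path is given by its list of (distinct) vertices, in order of traversal; its edges are
  \<open>A (xs ! i) (xs ! (i + 1))\<close>.  The reversed list is again a directed path, so quantifying over all
  directed paths covers both directions of traversal.
\<close>

definition directed_path :: "'v set set \<Rightarrow> 'v list \<Rightarrow> bool" where
  "directed_path E xs \<longleftrightarrow> 2 \<le> length xs \<and> distinct xs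
     \<and> (\<forall>i. i + 1 < length xs \<longrightarrow> {xs ! i, xs ! (i + 1)} \<in> E)"

definition good_path :: "('v \<Rightarrow> 'v \<Rightarrow> garc) \<Rightarrow> 'v list \<Rightarrow> bool" where
  "good_path A xs \<longleftrightarrow>
     (\<forall>i. i + 2 < length xs \<longrightarrow>
        chi (A (xs ! i) (xs ! (i + 1))) (A (xs ! (i + 1)) (xs ! (i + 2))) = 1) \<or>
     (\<forall>i. i + 2 < length xs \<longrightarrow>
        chi (A (xs ! i) (xs ! (i + 1))) (A (xs ! (i + 1)) (xs ! (i + 2))) = - 1)"

definition good_cycle :: "'v set set \<Rightarrow> ('v \<Rightarrow> 'v \<Rightarrow> garc) \<Rightarrow> bool" where
  "good_cycle E A \<longleftrightarrow> (\<forall>xs. directed_path E xs \<longrightarrow> good_path A xs)"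

definition cycle_verts :: "nat \<Rightarrow> nat set" where
  "cycle_verts n = {..<n}"

definition cycle_edges :: "nat \<Rightarrow> nat set set" where
  "cycle_edges n = {{i, (i + 1) mod n} | i. i < n}"

end

theory Submission
  imports Defs
begin

text \<open>
  Any linear functional restricted to a great circle is a sinusoid, so it changes sign exactly at
  antipodal pairs of zeros; the sign of a turn is the side of one arc on which its neighbour lies.

  If the turns from \<open>b\<close> to \<open>c\<close> and from \<open>c\<close> to \<open>d\<close> are opposite, then \<open>b\<close> and \<open>d\<close> leave \<open>c\<close>
  on different sides, so one of them must pass the antipode of its vertex on \<open>c\<close> before they can
  meet.  Say this is \<open>b\<close>.  Then \<open>b\<close> is long, hence \<open>c\<close> and the edge \<open>a\<close> preceding \<open>b\<close> are
  short.  Following the sides of the circles of \<open>b\<close>, \<open>c\<close>, \<open>d\<close> along \<open>a\<close>, which has to cross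
  both \<open>c\<close> and \<open>d\<close>, yields a contradiction.  If it is \<open>d\<close>, reverse the path.  For \<open>n \<ge> 5\<close>
  the required crossings are available around every edge, so all turns agree.

  If all edges are short, then each edge that does not meet \<open>e\<^sub>0\<close> at a vertex changes the side of
  \<open>e\<^sub>0\<close>, while both neighbours of \<open>e\<^sub>0\<close> lie on the same side; counting sign changes forces \<open>n\<close>
  to be odd.
\<close>

section \<open>Great-circle arcs and linear functionals along them\<close>

definition arc_normal :: "garc \<Rightarrow> real^3" where
  "arc_normal a = cross3 (src a) (dir0 a)"

text \<open>The triple product under the sign in \<open>chi\<close>, taken at a common endpoint with
  one-sided tangents. It is kept unsigned so that normals can later be scaled by it.\<close>

definition turn :: "garc \<Rightarrow> garc \<Rightarrow> real" where
  "turn a b = tgt a \<bullet> cross3 (arc_vel a (len a)) (dir0 b)"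

definition arcs_meet_once :: "garc \<Rightarrow> garc \<Rightarrow> bool" where
  "arcs_meet_once a b \<longleftrightarrow> (\<forall>x\<in>arc_points a \<inter> arc_points b. \<forall>y\<in>arc_points a \<inter> arc_points b. x = y)"

definition arcs_cross :: "garc \<Rightarrow> garc \<Rightarrow> bool" where
  "arcs_cross a b \<longleftrightarrow> arc_interior a \<inter> arc_interior b \<noteq> {}"

lemma arc_pt_shift: "arc_pt a t = cos (t - s) *\<^sub>R arc_pt a s + sin (t - s) *\<^sub>R arc_vel a s"
proof -
  have c: "cos t = cos (t - s) * cos s - sin (t - s) * sin s"
    using cos_add[of "t - s" s] by simp
  have s: "sin t = sin (t - s) * cos s + cos (t - s) * sin s"
    using sin_add[of "t - s" s] by simp
  show ?thesis
    unfolding arc_pt_def[of a t] c s by (simp add: arc_pt_def arc_vel_def algebra_simps)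
qed

text \<open>Used to read off sides: once a zero at \<open>s\<close> is known, the sign elsewhere on
  the arc is that of \<open>sin (t - s)\<close> up to a fixed factor.\<close>

lemma inner_arc_pt_zero:
  assumes "f \<bullet> arc_pt a s = 0"
  shows "f \<bullet> arc_pt a t = sin (t - s) * (f \<bullet> arc_vel a s)"
  by (subst arc_pt_shift[of a t s]) (simp add: inner_add_right assms)

lemma arc_pt_0 [simp]: "arc_pt a 0 = src a"
  by (simp add: arc_pt_def)

lemma arc_vel_0 [simp]: "arc_vel a 0 = dir0 a"
  by (simp add: arc_vel_def)

lemma inner_arc_pt_src_zero:
  assumes "f \<bullet> src a = 0"
  shows "f \<bullet> arc_pt a t = sin t * (f \<bullet> dir0 a)"
  using inner_arc_pt_zero[of f a 0 t] assms by simp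

lemma arc_pt_plus_pi: "arc_pt a (t + pi) = - arc_pt a t"
  by (simp add: arc_pt_def)

lemma norm_arc_pt:
  assumes "is_garc a"
  shows "norm (arc_pt a t) = 1"
proof -
  have "src a \<bullet> src a = 1" "dir0 a \<bullet> dir0 a = 1" "src a \<bullet> dir0 a = 0"
    using assms by (auto simp: is_garc_def norm_eq_1)
  then have "arc_pt a t \<bullet> arc_pt a t = (cos t)\<^sup>2 + (sin t)\<^sup>2"
    by (simp add: arc_pt_def inner_add_left inner_add_right inner_commute power2_eq_square)
  then show ?thesis by (simp add: norm_eq_1)
qed

lemma inner_arc_pt_arc_vel:
  assumes "is_garc a"
  shows "arc_pt a t \<bullet> arc_vel a t = 0"
proof -
  have "src a \<bullet> src a = 1" "dir0 a \<bullet> dir0 a = 1" "src a \<bullet> dir0 a = 0"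
    using assms by (auto simp: is_garc_def norm_eq_1)
  then show ?thesis
    by (simp add: arc_pt_def arc_vel_def inner_add_left inner_add_right inner_diff_right inner_commute)
qed

text \<open>The inner product of two points of an arc is the cosine of their parameter difference.
  It equals 1 only at multiples of \<open>2 * pi\<close>, and the arc is shorter than that.\<close>

lemma inj_on_arc_pt:
  assumes "is_garc a"
  shows "inj_on (arc_pt a) {0..len a}"
proof (rule inj_onI)
  fix s t assume st: "s \<in> {0..len a}" "t \<in> {0..len a}" "arc_pt a s = arc_pt a t"
  have "arc_pt a s \<bullet> arc_pt a s = 1"
    using norm_arc_pt[OF assms] by (simp add: norm_eq_1)
  then have "arc_pt a s \<bullet> arc_pt a t = cos (t - s)"
    using inner_arc_pt_arc_vel[OF assms]
    by (subst arc_pt_shift[of a t s]) (simp add: inner_add_right)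
  then have "cos \<bar>t - s\<bar> = 1"
    using st(3) norm_arc_pt[OF assms, of t] by (simp add: norm_eq_1)
  moreover have "\<bar>t - s\<bar> < 2 * pi"
    using st(1,2) assms by (auto simp: is_garc_def)
  moreover obtain k :: int where "\<bar>t - s\<bar> = of_int k * 2 * pi"
    using calculation(1) unfolding cos_one_2pi_int by blast
  ultimately have k: "\<bar>t - s\<bar> = of_int k * (2 * pi)" "of_int k * (2 * pi) < 1 * (2 * pi)"
    by simp_all
  moreover have "0 * (2 * pi) \<le> of_int k * (2 * pi)"
    using k(1) abs_ge_zero[of "t - s"] by simp
  ultimately have "(of_int k :: real) < 1" "(0 :: real) \<le> of_int k"
    by (simp_all add: mult_less_cancel_right zero_le_mult_iff not_le[THEN iffD2, OF pi_gt_zero])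
  then have "k = 0" by simp
  then have "\<bar>t - s\<bar> = 0" using k by simp
  then show "s = t" by simp
qed

lemma tangent_at_arc_pt:
  assumes "is_garc a" "t \<in> {0..len a}"
  shows "tangent_at a (arc_pt a t) = arc_vel a t"
proof -
  have "(THE s. s \<in> {0..len a} \<and> arc_pt a s = arc_pt a t) = t"
    using assms inj_on_arc_pt[OF assms(1)] by (intro the_equality) (auto dest: inj_onD)
  then show ?thesis by (simp add: tangent_at_def)
qed

lemma is_garc_len: "is_garc a \<Longrightarrow> 0 < len a" "is_garc a \<Longrightarrow> len a < 2 * pi"
  by (auto simp: is_garc_def)

lemma src_in_arc_points: "is_garc a \<Longrightarrow> src a \<in> arc_points a"
  unfolding arc_points_def using is_garc_len(1)[of a] by (intro image_eqI[of _ _ 0]) auto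

lemma tgt_in_arc_points: "is_garc a \<Longrightarrow> tgt a \<in> arc_points a"
  unfolding arc_points_def tgt_def using is_garc_len(1)[of a]
  by (intro image_eqI[of _ _ "len a"]) auto

text \<open>The definite descriptions behind \<open>chi\<close> resolve: the meeting point by
  \<open>arcs_meet_once\<close>, the tangents by injectivity at the parameters \<open>len a\<close>
  and \<open>0\<close>.\<close>

lemma chi_eq_sgn_turn:
  assumes "is_garc a" "is_garc b" "tgt a = src b" "arcs_meet_once a b"
  shows "chi a b = sgn (turn a b)"
proof -
  have *: "tgt a \<in> arc_points a \<inter> arc_points b"
    using tgt_in_arc_points[OF assms(1)] src_in_arc_points[OF assms(2)] assms(3) by simp
  then have "meeting_point a b = tgt a"
    using assms(4) unfolding meeting_point_def arcs_meet_once_def by (intro the_equality) auto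
  moreover have "tangent_at a (tgt a) = arc_vel a (len a)"
    using tangent_at_arc_pt[OF assms(1), of "len a"] is_garc_len[OF assms(1)] by (simp add: tgt_def)
  moreover have "tangent_at b (tgt a) = dir0 b"
    using tangent_at_arc_pt[OF assms(2), of 0] is_garc_len[OF assms(2)] assms(3) by simp
  ultimately show ?thesis by (simp add: chi_def turn_def)
qed

section \<open>Normals of great circles and the sign of a turn\<close>

lemma arc_normal_eq: "arc_normal a = cross3 (arc_pt a t) (arc_vel a t)"
proof -
  have "cross3 (dir0 a) (src a) = - cross3 (src a) (dir0 a)"
    by (rule cross_skew)
  then have "cross3 (arc_pt a t) (arc_vel a t) =
      (cos t * cos t) *\<^sub>R cross3 (src a) (dir0 a) + (sin t * sin t) *\<^sub>R cross3 (src a) (dir0 a)"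
    unfolding arc_pt_def arc_vel_def
    by (simp only: cross_add_left cross_add_right cross_mult_left cross_mult_right cross_refl)
      (simp add: algebra_simps)
  also have "\<dots> = cross3 (src a) (dir0 a)"
    by (simp flip: scaleR_add_left)
  finally have "cross3 (arc_pt a t) (arc_vel a t) = cross3 (src a) (dir0 a)" .
  then show ?thesis by (simp add: arc_normal_def)
qed

lemma inner_arc_normal [simp]:
  "arc_normal a \<bullet> src a = 0" "arc_normal a \<bullet> dir0 a = 0" "arc_normal a \<bullet> arc_pt a t = 0"
  "arc_normal a \<bullet> tgt a = 0"
  by (simp_all add: arc_normal_def dot_cross_self arc_pt_def inner_add_right tgt_def)

text \<open>Cyclic symmetry of the triple product. The sign of the turn is thus the side of
  \<open>a\<close> towards which \<open>b\<close> leaves.\<close>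

lemma turn_eq_arc_normal: "turn a b = arc_normal a \<bullet> dir0 b"
  unfolding turn_def tgt_def arc_normal_eq[of a "len a"] by (metis cross_triple inner_commute)

text \<open>The same turn seen from \<open>b\<close>: travelled backwards, \<open>a\<close> leaves
  the common point on the side of \<open>b\<close> with the sign of \<open>turn a b\<close>.\<close>

lemma turn_eq_neg_arc_normal:
  assumes "tgt a = src b"
  shows "turn a b = - (arc_normal b \<bullet> arc_vel a (len a))"
  unfolding turn_def assms arc_normal_def
  by (metis cross_skew cross_triple inner_commute inner_minus_right)

section \<open>Reversal of arcs\<close>

lemma arc_reverse_simps [simp]:
  "src (arc_reverse a) = tgt a" "dir0 (arc_reverse a) = - arc_vel a (len a)"
  "len (arc_reverse a) = len a"
  by (simp_all add: arc_reverse_def)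

lemma tgt_arc_reverse [simp]: "tgt (arc_reverse a) = src a"
  by (simp add: tgt_def[of "arc_reverse a"] arc_pt_reverse)

lemma arc_normal_reverse [simp]: "arc_normal (arc_reverse a) = - arc_normal a"
  by (simp add: arc_normal_def[of "arc_reverse a"] arc_normal_eq[of a "len a"] tgt_def cross_minus_right)

text \<open>Reversal negates normals and directions alike, so only the minus sign of
  \<open>turn_eq_neg_arc_normal\<close> remains.\<close>

lemma turn_reverse:
  assumes "tgt a = src b"
  shows "turn (arc_reverse b) (arc_reverse a) = - turn a b"
  using turn_eq_neg_arc_normal[OF assms] by (simp add: turn_eq_arc_normal)

lemma arc_pt_reverse_image: "arc_pt (arc_reverse a) ` S = arc_pt a ` (\<lambda>t. len a - t) ` S"
  by (simp add: image_image arc_pt_reverse)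

lemma arc_points_reverse [simp]: "arc_points (arc_reverse a) = arc_points a"
  unfolding arc_points_def arc_pt_reverse_image by (simp add: image_diff_atLeastAtMost)

lemma arc_interior_reverse [simp]: "arc_interior (arc_reverse a) = arc_interior a"
proof -
  have "(\<lambda>t. len a - t) ` {0<..<len a} = {0<..<len a}"
  proof (intro equalityI subsetI)
    fix t assume "t \<in> {0<..<len a}"
    then show "t \<in> (\<lambda>t. len a - t) ` {0<..<len a}"
      by (intro image_eqI[of _ _ "len a - t"]) auto
  qed auto
  then show ?thesis
    unfolding arc_interior_def arc_pt_reverse_image by simp
qed

lemma is_garc_reverse [simp]:
  assumes "is_garc a"
  shows "is_garc (arc_reverse a)"
proof -
  have "src a \<bullet> src a = 1" "dir0 a \<bullet> dir0 a = 1" "src a \<bullet> dir0 a = 0"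
    using assms by (auto simp: is_garc_def norm_eq_1)
  then have "arc_vel a t \<bullet> arc_vel a t = (cos t)\<^sup>2 + (sin t)\<^sup>2" for t
    by (simp add: arc_vel_def inner_diff_left inner_diff_right inner_commute power2_eq_square)
  then have "norm (arc_vel a t) = 1" for t by (simp add: norm_eq_1)
  then show ?thesis
    using norm_arc_pt[OF assms] inner_arc_pt_arc_vel[OF assms] assms
    by (simp add: is_garc_def tgt_def)
qed

lemma arcs_meet_once_reverse [simp]:
  "arcs_meet_once (arc_reverse a) b = arcs_meet_once a b"
  "arcs_meet_once a (arc_reverse b) = arcs_meet_once a b"
  by (simp_all add: arcs_meet_once_def)

lemma arcs_cross_reverse [simp]:
  "arcs_cross (arc_reverse a) b = arcs_cross a b"
  "arcs_cross a (arc_reverse b) = arcs_cross a b"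
  by (simp_all add: arcs_cross_def)

lemma arcs_meet_once_sym: "arcs_meet_once a b \<Longrightarrow> arcs_meet_once b a"
  by (auto simp: arcs_meet_once_def)

lemma arcs_cross_sym: "arcs_cross a b \<Longrightarrow> arcs_cross b a"
  by (auto simp: arcs_cross_def)

section \<open>Antipodal points and long arcs\<close>

lemma not_arcs_meet_once_antipodal:
  assumes "is_garc a" "x \<in> arc_points a" "x \<in> arc_points b" "- x \<in> arc_points a" "- x \<in> arc_points b"
  shows "\<not> arcs_meet_once a b"
proof
  assume "arcs_meet_once a b"
  then have "x = - x" using assms by (simp add: arcs_meet_once_def)
  then have "x = 0" by (simp add: vec_eq_iff)
  moreover have "norm x = 1" using assms(2) norm_arc_pt[OF assms(1)] by (auto simp: arc_points_def)
  ultimately show False by simp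
qed

lemma arc_pt_in_arc_points: "0 \<le> t \<Longrightarrow> t \<le> len a \<Longrightarrow> arc_pt a t \<in> arc_points a"
  by (simp add: arc_points_def)

lemma neg_arc_pt_in_arc_points:
  "0 \<le> t \<Longrightarrow> t + pi \<le> len a \<Longrightarrow> - arc_pt a t \<in> arc_points a"
  using arc_pt_in_arc_points[of "t + pi" a] by (simp add: arc_pt_plus_pi)

text \<open>An arc of length at least \<open>pi\<close> contains the antipode of its source, so two
  such arcs from one point would meet there again.\<close>

lemma short_of_long_neighbour:
  assumes "is_garc a" "is_garc b" "src a = src b" "arcs_meet_once a b" "pi < len a"
  shows "len b < pi"
proof (rule ccontr)
  assume "\<not> len b < pi"
  then have "- src b \<in> arc_points a" "- src b \<in> arc_points b"
    using neg_arc_pt_in_arc_points[of 0 a] neg_arc_pt_in_arc_points[of 0 b] assms(3,5) by auto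
  with not_arcs_meet_once_antipodal[OF assms(1), of "src b" b] show False
    using src_in_arc_points assms by metis
qed

section \<open>Excluding opposite consecutive turns\<close>

text \<open>The first two arcs of the path are reversed here, so that \<open>b\<close> and \<open>c\<close> leave a common vertex.
  The arcs \<open>b\<close> and \<open>d\<close> start on different sides of \<open>c\<close> and meet on the side of \<open>d\<close>, which makes
  \<open>b\<close> long.\<close>

lemma no_late_crossing:
  fixes a b c d :: garc
  assumes garc: "is_garc a" "is_garc b" "is_garc c" "is_garc d"
    and adj: "src a = tgt b" "src b = src c" "src d = tgt c"
    and N1: "N1 \<bullet> src b = 0" "N1 \<bullet> dir0 b = 0" "N1 \<bullet> dir0 c > 0"
    and N2: "N2 \<bullet> src c = 0" "N2 \<bullet> dir0 c = 0" "N2 \<bullet> dir0 b > 0" "N2 \<bullet> dir0 d < 0"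
    and N3: "N3 \<bullet> src d = 0" "N3 \<bullet> dir0 d = 0" "N3 \<bullet> arc_vel c (len c) \<noteq> 0"
    and once: "arcs_meet_once b a" "arcs_meet_once b c" "arcs_meet_once b d"
    and cross: "arcs_cross a c" "arcs_cross a d"
    and x: "x \<in> arc_interior b" "x \<in> arc_interior d" "N2 \<bullet> x < 0"
  shows False
proof -
  have N1b: "N1 \<bullet> arc_pt b u = 0" and N2c: "N2 \<bullet> arc_pt c u = 0"
    and N3d: "N3 \<bullet> arc_pt d u = 0" for u
    using N1 N2 N3 by (simp_all add: inner_arc_pt_src_zero)
  obtain s where s: "0 < s" "s < len b" "x = arc_pt b s"
    using x(1) by (auto simp: arc_interior_def)
  obtain t where t: "0 < t" "t < len d" "x = arc_pt d t"
    using x(2) by (auto simp: arc_interior_def)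
  have N2b: "N2 \<bullet> arc_pt b u = sin u * (N2 \<bullet> dir0 b)" for u
    using inner_arc_pt_src_zero[of N2 b u] N2 adj by simp
  have N2d: "N2 \<bullet> arc_pt d u = sin u * (N2 \<bullet> dir0 d)" for u
    using inner_arc_pt_src_zero[of N2 d u] N2c[of "len c"] adj by (simp add: tgt_def)
  \<comment> \<open>Since \<open>x\<close> is on the side of \<open>c\<close> to which
    \<open>d\<close> leaves, \<open>b\<close> has passed the antipode of its source before
    \<open>x\<close>, while \<open>d\<close> has not passed that of its own.\<close>
  have "sin s < 0" using x(3) s(3) N2b[of s] N2(3) by (simp add: mult_less_0_iff)
  then have s_pi: "pi < s" using sin_ge_zero[of s] s(1) by force
  have "0 < sin t" using x(3) t(3) N2d[of t] N2(4) by (simp add: mult_less_0_iff)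
  then have t_pi: "t < pi"
    using sin_le_zero[of t] t(2) is_garc_len(2)[OF garc(4)] by force
  have long: "pi < len b" using s s_pi by simp
  have c_short: "len c < pi"
    using short_of_long_neighbour[OF garc(2,3) adj(2) once(2) long] .
  have a_short: "len a < pi"
    using short_of_long_neighbour[of "arc_reverse b" a] garc adj once long by simp
  \<comment> \<open>Otherwise \<open>- x\<close> is a second common point, at \<open>s - pi\<close>
    on \<open>b\<close> and at \<open>t + pi\<close> on \<open>d\<close>. The bound later lets the
    sign of \<open>sin (t3 - t)\<close> order \<open>t3\<close> and \<open>t\<close>.\<close>
  have len_d: "len d < t + pi"
  proof (rule ccontr)
    assume "\<not> len d < t + pi"
    then have "- x \<in> arc_points d" using neg_arc_pt_in_arc_points[of t d] t by simp
    moreover have "- x \<in> arc_points b"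
      using arc_pt_in_arc_points[of "s - pi" b] arc_pt_plus_pi[of b "s - pi"] s s_pi
        pi_gt_zero by auto
    moreover have "x \<in> arc_points b" "x \<in> arc_points d"
      using s t arc_pt_in_arc_points[of s b] arc_pt_in_arc_points[of t d] by simp_all
    ultimately show False
      using not_arcs_meet_once_antipodal[OF garc(2)] once(3) by blast
  qed
  obtain q2 where "q2 \<in> arc_interior a" "q2 \<in> arc_interior c"
    using cross(1) by (auto simp: arcs_cross_def)
  then obtain s2 t2 where q2: "0 < s2" "s2 < len a" "q2 = arc_pt a s2"
      "0 < t2" "t2 < len c" "q2 = arc_pt c t2"
    by (auto simp: arc_interior_def)
  obtain q3 where "q3 \<in> arc_interior a" "q3 \<in> arc_interior d"
    using cross(2) by (auto simp: arcs_cross_def)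
  then obtain s3 t3 where q3: "0 < s3" "s3 < len a" "q3 = arc_pt a s3"
      "0 < t3" "t3 < len d" "q3 = arc_pt d t3"
    by (auto simp: arc_interior_def)

  \<comment> \<open>\<open>N1\<close> vanishes on the circle of \<open>b\<close>. The short arcs
    \<open>c\<close> and \<open>a\<close> start there, so their interiors each keep one side, the
    same one because they meet. As \<open>d\<close> starts on that side and leaves it at
    \<open>x\<close>, it meets \<open>a\<close> before \<open>x\<close>.\<close>
  have N1c: "N1 \<bullet> arc_pt c u = sin u * (N1 \<bullet> dir0 c)" for u
    using inner_arc_pt_src_zero[of N1 c u] N1 adj by simp
  have N1a: "N1 \<bullet> arc_pt a u = sin u * (N1 \<bullet> dir0 a)" for u
    using inner_arc_pt_src_zero[of N1 a u] N1b[of "len b"] adj by (simp add: tgt_def)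
  have "0 < N1 \<bullet> q2"
    using N1c[of t2] q2 c_short N1(3) sin_gt_zero[of t2] by simp
  then have "0 < N1 \<bullet> dir0 a"
    using N1a[of s2] q2 a_short sin_gt_zero[of s2] by (simp add: zero_less_mult_iff)
  then have N1q3: "0 < N1 \<bullet> q3"
    using N1a[of s3] q3 a_short sin_gt_zero[of s3] by simp
  have N1d: "N1 \<bullet> arc_pt d u = sin (u - t) * (N1 \<bullet> arc_vel d t)" for u
    using inner_arc_pt_zero[of N1 d t u] N1b[of s] s t by simp
  have "N1 \<bullet> arc_vel d t < 0"
  proof -
    have "0 < N1 \<bullet> tgt c"
      using N1c[of "len c"] sin_gt_zero[of "len c"] c_short is_garc_len(1)[OF garc(3)] N1(3)
      by (simp add: tgt_def)
    then show ?thesis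
      using N1d[of 0] adj sin_gt_zero[OF t(1) t_pi] by (simp add: mult_less_0_iff)
  qed
  then have "sin (t3 - t) < 0"
    using N1q3 N1d[of t3] q3(6) by (simp add: zero_less_mult_iff)
  then have t3: "t3 < t"
    using sin_ge_zero[of "t3 - t"] q3 len_d by force
  \<comment> \<open>\<open>N2\<close> vanishes on the circle of \<open>c\<close>. The long
    \<open>b\<close> ends on its negative side, so \<open>a\<close> starts there and leaves it at
    \<open>q2\<close>. Since \<open>q3\<close> is also negative, it precedes \<open>q2\<close> on
    \<open>a\<close>.\<close>
  have N2q3: "N2 \<bullet> q3 < 0"
    using N2d[of t3] q3 t3 t_pi sin_gt_zero[of t3] N2(4) by (simp add: mult_less_0_iff)
  have N2a: "N2 \<bullet> arc_pt a u = sin (u - s2) * (N2 \<bullet> arc_vel a s2)" for u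
    using inner_arc_pt_zero[of N2 a s2 u] N2c[of t2] q2 by simp
  have "0 < N2 \<bullet> arc_vel a s2"
  proof -
    have "N2 \<bullet> src a < 0"
      using N2b[of "len b"] sin_lt_zero[OF long] is_garc_len(2)[OF garc(2)] N2(3) adj
      by (simp add: tgt_def mult_less_0_iff)
    then show ?thesis
      using N2a[of 0] sin_gt_zero[of s2] q2 a_short by (simp add: zero_less_mult_iff)
  qed
  then have "sin (s3 - s2) < 0"
    using N2q3 N2a[of s3] q3(3) by (simp add: mult_less_0_iff)
  then have s3: "s3 < s2"
    using sin_ge_zero[of "s3 - s2"] q2 q3 a_short by force

  \<comment> \<open>\<open>N3\<close> vanishes on the circle of \<open>d\<close>, and its zero
    \<open>q3\<close> separates \<open>src a\<close> from \<open>q2\<close> on the short arc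
    \<open>a\<close>.\<close>
  have N3a: "N3 \<bullet> arc_pt a u = sin (u - s3) * (N3 \<bullet> arc_vel a s3)" for u
    using inner_arc_pt_zero[of N3 a s3 u] N3d[of t3] q3 by simp
  have opposite: "(N3 \<bullet> src a) * (N3 \<bullet> q2) \<le> 0"
  proof -
    have "(N3 \<bullet> src a) * (N3 \<bullet> q2) = - (sin s3 * sin (s2 - s3)) * (N3 \<bullet> arc_vel a s3)\<^sup>2"
      using N3a[of 0] N3a[of s2] q2 by (simp add: power2_eq_square)
    moreover have "0 \<le> sin s3 * sin (s2 - s3)"
      using s3 q2 q3 a_short by (intro mult_nonneg_nonneg sin_ge_zero) auto
    ultimately show ?thesis by (simp add: mult_nonneg_nonneg)
  qed
  \<comment> \<open>The detour through \<open>b\<close> and \<open>c\<close> says the opposite. On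
    the short \<open>c\<close> there is no zero before \<open>tgt c\<close>, so \<open>src c\<close>
    and \<open>q2\<close> agree in sign. On \<open>b\<close> there are two zeros, at
    \<open>s - pi\<close> and \<open>s\<close>, so \<open>src b\<close> and \<open>tgt b\<close>
    agree as well.\<close>
  have N3c: "N3 \<bullet> arc_pt c u = - (sin (len c - u) * (N3 \<bullet> arc_vel c (len c)))" for u
    using inner_arc_pt_zero[of N3 c "len c" u] N3d[of 0] adj sin_minus[of "len c - u"]
    by (simp add: tgt_def)
  have N3b: "N3 \<bullet> arc_pt b u = sin (u - s) * (N3 \<bullet> arc_vel b s)" for u
    using inner_arc_pt_zero[of N3 b s u] N3d[of t] s t by simp
  define m where "m = N3 \<bullet> arc_vel c (len c)"
  define r where "r = N3 \<bullet> arc_vel b s"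
  \<comment> \<open>Both expansions are compared at the common source of \<open>b\<close> and
    \<open>c\<close>.\<close>
  have "sin (len c) * m = sin s * r"
    using N3c[of 0] N3b[of 0] adj by (simp add: m_def r_def)
  moreover have "0 < sin (len c)"
    using sin_gt_zero c_short is_garc_len(1)[OF garc(3)] by simp
  ultimately have "m * r < 0"
    using \<open>sin s < 0\<close> N3(3)
    by (smt (verit) m_def mult_less_0_iff mult_eq_0_iff zero_less_mult_iff)
  moreover have "0 < sin (len b - s)"
    using s s_pi is_garc_len(2)[OF garc(2)] by (intro sin_gt_zero) auto
  moreover have "0 < sin (len c - t2)"
    using q2 c_short by (intro sin_gt_zero) auto
  moreover have "(N3 \<bullet> src a) * (N3 \<bullet> q2) = - (sin (len b - s) * sin (len c - t2)) * (m * r)"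
    using N3b[of "len b"] N3c[of t2] q2 adj by (simp add: tgt_def m_def r_def)
  ultimately have "0 < (N3 \<bullet> src a) * (N3 \<bullet> q2)"
    by (simp add: mult_less_0_iff mult_pos_neg)
  with opposite show False by simp
qed

text \<open>Scaling the normals by \<open>turn b c\<close> makes one orientation cover both signs of
  the turn. The conclusion keeps \<open>x\<close> from lying strictly on the side of
  \<open>c\<close> to which \<open>d\<close> leaves.\<close>

lemma no_late_crossing_path:
  assumes garc: "is_garc a" "is_garc b" "is_garc c" "is_garc d"
    and adj: "tgt a = src b" "tgt b = src c" "tgt c = src d"
    and turns: "turn b c * turn c d < 0"
    and once: "arcs_meet_once a b" "arcs_meet_once b c" "arcs_meet_once b d"
    and cross: "arcs_cross a c" "arcs_cross a d"
    and x: "x \<in> arc_interior b" "x \<in> arc_interior d"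
  shows "0 \<le> turn b c * (arc_normal c \<bullet> x)"
proof (rule ccontr)
  assume neg: "\<not> 0 \<le> turn b c * (arc_normal c \<bullet> x)"
  have nz: "turn b c \<noteq> 0" "turn c d \<noteq> 0" using turns by auto
  have sq: "0 < turn b c * turn b c" using nz by (auto simp: zero_less_mult_iff linorder_neq_iff)
  show False
  proof (rule no_late_crossing[where a = "arc_reverse a" and b = "arc_reverse b" and c = c and d = d
        and x = x and ?N1.0 = "turn b c *\<^sub>R arc_normal b" and ?N2.0 = "turn b c *\<^sub>R arc_normal c"
        and ?N3.0 = "arc_normal d"])
    show "(turn b c *\<^sub>R arc_normal b) \<bullet> src (arc_reverse b) = 0"
      by simp
    show "(turn b c *\<^sub>R arc_normal b) \<bullet> dir0 (arc_reverse b) = 0"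
      by (simp add: arc_normal_eq[of b "len b"] dot_cross_self)
    show "0 < (turn b c *\<^sub>R arc_normal b) \<bullet> dir0 c"
      using sq by (simp flip: turn_eq_arc_normal)
    show "0 < (turn b c *\<^sub>R arc_normal c) \<bullet> dir0 (arc_reverse b)"
      using sq turn_eq_neg_arc_normal[OF adj(2)] by simp
    show "(turn b c *\<^sub>R arc_normal c) \<bullet> dir0 d < 0"
      using turns by (simp flip: turn_eq_arc_normal)
    show "arc_normal d \<bullet> arc_vel c (len c) \<noteq> 0"
      using nz turn_eq_neg_arc_normal[OF adj(3)] by simp
  qed (use assms neg in \<open>auto intro: arcs_meet_once_sym\<close>)
qed

text \<open>The path and its reversal bound the crossing of \<open>b\<close> and \<open>d\<close>
  from both sides of \<open>c\<close>, so it lies on the circle of \<open>c\<close>. There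
  \<open>b\<close> and \<open>d\<close> can cross only at the antipodes of their own vertices on
  \<open>c\<close>, and these antipodes differ.\<close>

lemma turns_agree:
  assumes garc: "is_garc a" "is_garc b" "is_garc c" "is_garc d" "is_garc e"
    and adj: "tgt a = src b" "tgt b = src c" "tgt c = src d" "tgt d = src e"
    and ne: "src c \<noteq> tgt c"
    and once: "arcs_meet_once a b" "arcs_meet_once b c" "arcs_meet_once b d"
      "arcs_meet_once c d" "arcs_meet_once d e"
    and cross: "arcs_cross a c" "arcs_cross a d" "arcs_cross b d" "arcs_cross b e" "arcs_cross c e"
  shows "0 \<le> turn b c * turn c d"
proof (rule ccontr)
  assume "\<not> 0 \<le> turn b c * turn c d"
  then have turns: "turn b c * turn c d < 0" by simp
  obtain x where x: "x \<in> arc_interior b" "x \<in> arc_interior d"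
    using cross(3) by (auto simp: arcs_cross_def)
  have 1: "0 \<le> turn b c * (arc_normal c \<bullet> x)"
    using no_late_crossing_path[of a b c d x] assms turns x by simp
  \<comment> \<open>Reversal negates both \<open>turn c d\<close> and the normal of
    \<open>c\<close>, so the signs cancel.\<close>
  have 2: "0 \<le> turn c d * (arc_normal c \<bullet> x)"
    using no_late_crossing_path[of "arc_reverse e" "arc_reverse d" "arc_reverse c" "arc_reverse b" x]
      garc adj turns x once cross
    by (simp add: turn_reverse mult.commute arcs_meet_once_sym arcs_cross_sym)
  have zero: "arc_normal c \<bullet> x = 0"
    using 1 2 turns by (smt (verit) mult_less_0_iff zero_le_mult_iff)
  \<comment> \<open>The parameter lies strictly between 0 and \<open>2 * pi\<close>, where sine
    vanishes only at \<open>pi\<close>.\<close>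
  have antipode: "y = - src f"
    if "is_garc f" "y \<in> arc_interior f" "N \<bullet> src f = 0" "N \<bullet> dir0 f \<noteq> 0" "N \<bullet> y = 0" for f y N
  proof -
    obtain u where u: "0 < u" "u < len f" "y = arc_pt f u"
      using \<open>y \<in> arc_interior f\<close> by (auto simp: arc_interior_def)
    have "sin u = 0" using that(3-5) u(3) by (simp add: inner_arc_pt_src_zero)
    then have "u = pi"
      using u(1,2) is_garc_len(2)[OF that(1)] sin_gt_zero[of u] sin_lt_zero[of u] by force
    then show ?thesis using u(3) arc_pt_plus_pi[of f 0] by simp
  qed
  have "x = - src (arc_reverse b)"
    using garc x zero turns turn_eq_neg_arc_normal[OF adj(2)]
    by (intro antipode[of _ _ "arc_normal c"]) (auto simp: adj(2))
  moreover have "x = - src d"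
    using garc x zero turns turn_eq_arc_normal[of c d]
    by (intro antipode[of _ _ "arc_normal c"]) (auto simp flip: adj(3))
  ultimately show False using ne adj by simp
qed

section \<open>Degenerate turns and side changes\<close>

lemma great_circle_eq_of_turn_zero:
  assumes "is_garc a" "is_garc b" "tgt a = src b" "turn a b = 0"
  shows "great_circle a = great_circle b"
proof -
  define p u w where "p = src b" and "u = arc_vel a (len a)" and "w = dir0 b"
  have norms: "norm p = 1" "norm u = 1" "norm w = 1" and orth: "p \<bullet> u = 0" "p \<bullet> w = 0"
    using assms is_garc_reverse[OF assms(1)] inner_arc_pt_arc_vel[OF assms(1), of "len a"]
    by (auto simp: p_def u_def w_def is_garc_def tgt_def)
  \<comment> \<open>Both tangents are orthogonal to \<open>p\<close>, so their cross product is
    parallel to \<open>p\<close>. A zero turn makes it orthogonal to \<open>p\<close> too, hence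
    zero.\<close>
  have "cross3 p (cross3 u w) = 0"
    using orth by (simp add: Lagrange)
  moreover have "p \<bullet> cross3 u w = 0"
    using assms(3,4) by (simp add: turn_def p_def u_def w_def)
  ultimately have "cross3 u w = 0"
    using norm_and_cross_eq_0[of p "cross3 u w"] norms by auto
  then have "cross3 w (cross3 u w) = 0" by simp
  then have "u = (w \<bullet> u) *\<^sub>R w"
    using norms(3) by (simp add: Lagrange norm_eq_1)
  moreover from this have "\<bar>w \<bullet> u\<bar> = 1"
    using norms(2,3) by (metis norm_scaleR mult.right_neutral)
  ultimately have "u = w \<or> u = - w"
    by (smt (verit) scaleR_minus1_left scaleR_one)
  then obtain k :: real where k: "k = 1 \<or> k = - 1" "u = k *\<^sub>R w" by force
  have a: "arc_pt a (len a + s) = cos s *\<^sub>R p + sin s *\<^sub>R u" for s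
    by (subst arc_pt_shift[of a _ "len a"]) (simp add: p_def u_def flip: assms(3), simp add: tgt_def)
  have b: "arc_pt b s = cos s *\<^sub>R p + sin s *\<^sub>R w" for s
    by (simp add: arc_pt_def p_def w_def)
  \<comment> \<open>The parametrizations agree up to a shift by \<open>len a\<close> and, for
    \<open>k = - 1\<close>, a reversal of time.\<close>
  have ab: "arc_pt a (len a + s) = arc_pt b (k * s)" for s
    using k by (auto simp: a b)
  have "arc_pt a s \<in> great_circle b" for s
    using ab[of "s - len a"] by (simp add: great_circle_def)
  moreover have "arc_pt b s \<in> great_circle a" for s
    using ab[of "k * s"] k(1) rangeI[of "arc_pt a" "len a + k * s"]
    by (auto simp: great_circle_def)
  ultimately show ?thesis
    unfolding great_circle_def by blast
qed

text \<open>An arc shorter than \<open>pi\<close> has no room for a second zero of the sinusoid, and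
  the nonzero value at the source prevents it from vanishing identically.\<close>

lemma short_arc_changes_side:
  assumes "len a < pi" "x \<in> arc_interior a" "N \<bullet> x = 0" "N \<bullet> src a \<noteq> 0"
  shows "(N \<bullet> src a) * (N \<bullet> tgt a) < 0"
proof -
  obtain t where t: "0 < t" "t < len a" "x = arc_pt a t"
    using assms(2) by (auto simp: arc_interior_def)
  have N: "N \<bullet> arc_pt a u = sin (u - t) * (N \<bullet> arc_vel a t)" for u
    using inner_arc_pt_zero[of N a t u] assms(3) t by simp
  have "(N \<bullet> src a) * (N \<bullet> tgt a) = - (sin t * sin (len a - t)) * (N \<bullet> arc_vel a t)\<^sup>2"
    using N[of 0] N[of "len a"] by (simp add: tgt_def power2_eq_square)
  moreover have "0 < sin t * sin (len a - t)"
    using t assms(1) by (intro mult_pos_pos sin_gt_zero) auto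
  moreover have "N \<bullet> arc_vel a t \<noteq> 0"
    using N[of 0] assms(4) by auto
  ultimately show ?thesis by (simp add: mult_pos_pos)
qed

section \<open>Cyclic indexing of the edges\<close>

lemma add_mod_eq_imp_zero:
  fixes i k n :: nat
  assumes "(i + k) mod n = i mod n" "k < n"
  shows "k = 0"
  using assms mod_eq_dvd_iff_nat[of i "i + k" n] by (auto dest: dvd_imp_le)

locale cycle_thrackle =
  fixes n :: nat and pos :: "nat \<Rightarrow> real^3" and A :: "nat \<Rightarrow> nat \<Rightarrow> garc"
  assumes n: "5 \<le> n"
    and thrackle: "spherical_thrackle (cycle_verts n) (cycle_edges n) pos A"
    and general: "general_position (cycle_edges n) A"
begin

text \<open>Indexed by all natural numbers, so that windows of consecutive edges need no wrap-around
  cases.\<close>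

definition edge :: "nat \<Rightarrow> garc" where
  "edge i = A (i mod n) (Suc i mod n)"

lemma edge_mod: "edge (i mod n) = edge i"
  by (simp add: edge_def mod_Suc_eq)

lemma cycle_edges_Suc: "{i mod n, Suc i mod n} \<in> cycle_edges n"
  unfolding cycle_edges_def using n by (auto intro!: exI[of _ "i mod n"] simp: mod_Suc_eq)

lemma drawing: "spherical_drawing (cycle_verts n) (cycle_edges n) pos A"
  using thrackle by (simp add: spherical_thrackle_def)

lemma is_garc_edge: "is_garc (edge i)"
  and src_edge: "src (edge i) = pos (i mod n)"
  and tgt_edge: "tgt (edge i) = pos (Suc i mod n)"
  and reverse_edge: "A (Suc i mod n) (i mod n) = arc_reverse (edge i)"
  using drawing cycle_edges_Suc[of i] by (auto simp: spherical_drawing_def edge_def)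

lemma tgt_edge_eq: "tgt (edge i) = src (edge (Suc i))"
  by (simp add: src_edge tgt_edge)

lemma mod_add_neq:
  assumes "0 < d" "d < n"
  shows "(i + d) mod n \<noteq> i mod n"
  using add_mod_eq_imp_zero[of i d n] assms by auto

lemma src_edge_neq_tgt: "src (edge i) \<noteq> tgt (edge i)"
proof -
  have "i mod n \<noteq> Suc i mod n" using mod_add_neq[of 1 i] n by simp
  moreover have "i mod n \<in> cycle_verts n" "Suc i mod n \<in> cycle_verts n"
    using n by (simp_all add: cycle_verts_def)
  moreover have "inj_on pos (cycle_verts n)" using drawing by (simp add: spherical_drawing_def)
  ultimately show ?thesis by (auto simp: src_edge tgt_edge dest: inj_onD)
qed

lemma edges_distinct:
  assumes "0 < d" "d < n"
  shows "{i mod n, Suc i mod n} \<noteq> {(i + d) mod n, Suc (i + d) mod n}"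
proof
  assume eq: "{i mod n, Suc i mod n} = {(i + d) mod n, Suc (i + d) mod n}"
  \<comment> \<open>Different first vertices force a swapped pair, which would close the cycle after
    two steps.\<close>
  have "i mod n \<noteq> (i + d) mod n" using mod_add_neq[OF assms, of i] by simp
  with eq have "i mod n = Suc (i + d) mod n" "Suc i mod n = (i + d) mod n"
    by (auto simp: doubleton_eq_iff)
  then have "Suc (Suc i) mod n = i mod n" by (metis mod_Suc_eq)
  then show False using mod_add_neq[of 2 i] n by simp
qed

lemma edges_disjoint:
  assumes "2 \<le> d" "d + 2 \<le> n"
  shows "{i mod n, Suc i mod n} \<inter> {(i + d) mod n, Suc (i + d) mod n} = {}"
proof -
  \<comment> \<open>The four index differences are \<open>d\<close>, \<open>d + 1\<close>,
    \<open>d - 1\<close> and \<open>d\<close>, all strictly between 0 and \<open>n\<close>.\<close>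
  have "(i + d) mod n \<noteq> i mod n" "(i + Suc d) mod n \<noteq> i mod n"
    "(Suc i + (d - 1)) mod n \<noteq> Suc i mod n" "(Suc i + d) mod n \<noteq> Suc i mod n"
    using assms by (intro mod_add_neq; simp)+
  then show ?thesis using assms by auto
qed

lemma edges_meet:
  assumes "0 < d" "d < n"
  shows "\<exists>p. arc_points (edge i) \<inter> arc_points (edge (i + d)) = {p} \<and>
    (p \<in> pos ` ({i mod n, Suc i mod n} \<inter> {(i + d) mod n, Suc (i + d) mod n})
      \<or> proper_crossing (edge i) (edge (i + d)) p)"
  using thrackle cycle_edges_Suc[of i] cycle_edges_Suc[of "i + d"] edges_distinct[OF assms, of i]
  unfolding spherical_thrackle_def edge_def by blast

lemma edges_meet_once:
  assumes "0 < d" "d < n"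
  shows "arcs_meet_once (edge i) (edge (i + d))"
  using edges_meet[OF assms, of i] by (fastforce simp: arcs_meet_once_def)

lemma edges_cross:
  assumes "2 \<le> d" "d + 2 \<le> n"
  shows "arcs_cross (edge i) (edge (i + d))"
proof -
  have d: "0 < d" "d < n" using assms by auto
  obtain p where "proper_crossing (edge i) (edge (i + d)) p"
    using edges_meet[OF d, of i] edges_disjoint[OF assms, of i] by auto
  then show ?thesis by (auto simp: proper_crossing_def arcs_cross_def)
qed

section \<open>Equality of all turns and goodness of the cycle\<close>

definition vertex_turn :: "nat \<Rightarrow> real" where
  "vertex_turn i = turn (edge i) (edge (Suc i))"

lemma vertex_turn_nonzero: "vertex_turn i \<noteq> 0"
proof
  assume "vertex_turn i = 0"
  then have "great_circle (edge i) = great_circle (edge (Suc i))"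
    using great_circle_eq_of_turn_zero is_garc_edge tgt_edge_eq by (simp add: vertex_turn_def)
  moreover have "{i mod n, Suc i mod n} \<noteq> {Suc i mod n, Suc (Suc i) mod n}"
    using edges_distinct[of 1 i] n by simp
  ultimately show False
    using general cycle_edges_Suc[of i] cycle_edges_Suc[of "Suc i"]
    unfolding general_position_def edge_def by blast
qed

lemma vertex_turn_periodic: "vertex_turn (i + n) = vertex_turn i"
  by (simp add: vertex_turn_def edge_def mod_Suc_eq flip: add_Suc)

lemma sgn_vertex_turn_Suc: "sgn (vertex_turn (Suc (Suc i))) = sgn (vertex_turn (Suc i))"
proof -
  \<comment> \<open>Five consecutive edges act as \<open>a\<close> to \<open>e\<close>. The
    crossings at offset 3 are available because \<open>n \<ge> 5\<close>.\<close>
  have "0 \<le> turn (edge (i + 1)) (edge (i + 2)) * turn (edge (i + 2)) (edge (i + 3))"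
  proof (rule turns_agree)
    show "tgt (edge i) = src (edge (i + 1))" "tgt (edge (i + 1)) = src (edge (i + 2))"
      "tgt (edge (i + 2)) = src (edge (i + 3))" "tgt (edge (i + 3)) = src (edge (i + 4))"
      by (simp_all add: tgt_edge_eq eval_nat_numeral)
    show "arcs_meet_once (edge i) (edge (i + 1))" "arcs_meet_once (edge (i + 1)) (edge (i + 2))"
      "arcs_meet_once (edge (i + 1)) (edge (i + 3))" "arcs_meet_once (edge (i + 2)) (edge (i + 3))"
      "arcs_meet_once (edge (i + 3)) (edge (i + 4))"
      using edges_meet_once[of 1 i] edges_meet_once[of 1 "i + 1"] edges_meet_once[of 2 "i + 1"]
        edges_meet_once[of 1 "i + 2"] edges_meet_once[of 1 "i + 3"] n
      by (simp_all add: eval_nat_numeral)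
    show "arcs_cross (edge i) (edge (i + 2))" "arcs_cross (edge i) (edge (i + 3))"
      "arcs_cross (edge (i + 1)) (edge (i + 3))" "arcs_cross (edge (i + 1)) (edge (i + 4))"
      "arcs_cross (edge (i + 2)) (edge (i + 4))"
      using edges_cross[of 2 i] edges_cross[of 3 i] edges_cross[of 2 "i + 1"]
        edges_cross[of 3 "i + 1"] edges_cross[of 2 "i + 2"] n
      by (simp_all add: eval_nat_numeral)
  qed (simp_all add: is_garc_edge src_edge_neq_tgt)
  then have "0 \<le> vertex_turn (Suc i) * vertex_turn (Suc (Suc i))"
    by (simp add: vertex_turn_def eval_nat_numeral)
  then show ?thesis
    using vertex_turn_nonzero[of "Suc i"] vertex_turn_nonzero[of "Suc (Suc i)"]
    by (auto simp: sgn_if zero_le_mult_iff)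
qed

lemma sgn_vertex_turn: "sgn (vertex_turn i) = sgn (vertex_turn 0)"
proof -
  have *: "sgn (vertex_turn (Suc j)) = sgn (vertex_turn (Suc 0))" for j
    by (induction j) (simp_all add: sgn_vertex_turn_Suc)
  \<comment> \<open>Going once around replaces \<open>j\<close> by the successor
    \<open>j + n\<close>, which also covers \<open>j = 0\<close>.\<close>
  have "sgn (vertex_turn j) = sgn (vertex_turn (Suc 0))" for j
    using *[of "j + n - 1"] vertex_turn_periodic[of j] n by simp
  then show ?thesis by metis
qed

lemma chi_forward:
  assumes "x < n" "y = Suc x mod n" "z = Suc y mod n"
  shows "chi (A x y) (A y z) = sgn (vertex_turn 0)"
proof -
  have "A x y = edge x" "A y z = edge (Suc x)"
    using assms by (simp_all add: edge_def mod_Suc_eq)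
  then show ?thesis
    using chi_eq_sgn_turn[OF is_garc_edge is_garc_edge tgt_edge_eq, of x] edges_meet_once[of 1 x] n
      sgn_vertex_turn[of x]
    by (simp add: vertex_turn_def)
qed

lemma chi_backward:
  assumes "z < n" "y = Suc z mod n" "x = Suc y mod n"
  shows "chi (A x y) (A y z) = - sgn (vertex_turn 0)"
proof -
  have "A y z = arc_reverse (edge z)" "A x y = arc_reverse (edge (Suc z))"
    using assms reverse_edge[of z] reverse_edge[of "Suc z"] by (simp_all add: mod_Suc_eq)
  moreover have "arcs_meet_once (edge (Suc z)) (edge z)"
    using edges_meet_once[of 1 z] n by (auto intro: arcs_meet_once_sym)
  ultimately show ?thesis
    using chi_eq_sgn_turn[of "arc_reverse (edge (Suc z))" "arc_reverse (edge z)"] is_garc_edge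
      tgt_edge_eq[of z] turn_reverse[OF tgt_edge_eq[of z]] sgn_vertex_turn[of z]
    by (simp add: vertex_turn_def sgn_minus)
qed

lemma cycle_edges_cases:
  assumes "{x, y} \<in> cycle_edges n"
  shows "x < n" "y < n" "y = Suc x mod n \<or> x = Suc y mod n"
  using assms n by (auto simp: cycle_edges_def doubleton_eq_iff)

lemma good_cycle: "good_cycle (cycle_edges n) A"
  unfolding good_cycle_def
proof (intro allI impI)
  fix xs assume path: "directed_path (cycle_edges n) xs"
  have dist: "distinct xs"
    using path by (auto simp: directed_path_def)
  have step: "xs ! i < n" "xs ! Suc i < n"
    "xs ! Suc i = Suc (xs ! i) mod n \<or> xs ! i = Suc (xs ! Suc i) mod n" if "Suc i < length xs" for i
    using cycle_edges_cases[of "xs ! i" "xs ! Suc i"] path that by (auto simp: directed_path_def)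
  \<comment> \<open>A path with distinct vertices cannot change direction: it would return to the
    vertex two places earlier.\<close>
  have fwd: "xs ! Suc (Suc i) = Suc (xs ! Suc i) mod n \<longleftrightarrow> xs ! Suc i = Suc (xs ! i) mod n"
    if i: "Suc (Suc i) < length xs" for i
  proof -
    have ne: "xs ! i \<noteq> xs ! Suc (Suc i)"
      using dist i by (simp add: nth_eq_iff_index_eq)
    have inj: "u = v" if "Suc u mod n = Suc v mod n" "u < n" "v < n" for u v
      using that by (auto simp: mod_Suc split: if_splits)
    show ?thesis
      using step[of i] step[of "Suc i"] i ne inj by (metis Suc_lessD)
  qed
  let ?c = "sgn (vertex_turn 0)"
  have c: "?c = 1 \<or> ?c = - 1" using vertex_turn_nonzero[of 0] by (auto simp: sgn_if)
  have all: "xs ! Suc i = Suc (xs ! i) mod n \<longleftrightarrow> xs ! Suc 0 = Suc (xs ! 0) mod n"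
    if "Suc i < length xs" for i
    using that by (induction i) (auto simp: fwd)
  let ?chi = "\<lambda>i. chi (A (xs ! i) (xs ! (i + 1))) (A (xs ! (i + 1)) (xs ! (i + 2)))"
  have "?chi i = (if xs ! Suc 0 = Suc (xs ! 0) mod n then ?c else - ?c)"
    if i: "i + 2 < length xs" for i
  proof (cases "xs ! Suc 0 = Suc (xs ! 0) mod n")
    case True
    then show ?thesis
      using all[of i] all[of "Suc i"] step(1)[of i] i by (auto intro!: chi_forward)
  next
    case False
    then have "xs ! i = Suc (xs ! Suc i) mod n" "xs ! Suc i = Suc (xs ! Suc (Suc i)) mod n"
      using all[of i] all[of "Suc i"] step(3)[of i] step(3)[of "Suc i"] i by auto
    then show ?thesis
      using False step(2)[of "Suc i"] i by (auto intro!: chi_backward)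
  qed
  then show "good_path A xs"
    unfolding good_path_def using c by (auto split: if_splits)
qed

section \<open>Parity when all edges are short\<close>

lemma odd_if_all_short:
  assumes short: "\<And>i. len (edge i) < pi"
  shows "odd n"
proof
  assume "even n"
  define N where "N = arc_normal (edge 0)"
  \<comment> \<open>This is the turn at vertex 1, from edge 0 into edge 1.\<close>
  define T where "T = vertex_turn 0"
  \<comment> \<open>Sides of the vertices 2 to \<open>n - 1\<close>: edge 1 reaches vertex 2 on the
    side given by \<open>T\<close>, and each of the edges 2 to \<open>n - 2\<close> crosses edge 0
    and flips the side.\<close>
  have side: "0 < T * (-1) ^ k * (N \<bullet> src (edge (k + 2)))" if "k + 3 \<le> n" for k
    using that
  proof (induction k)
    case 0
    have "N \<bullet> src (edge 1) = 0" using tgt_edge_eq[of 0] by (simp add: N_def flip: tgt_edge_eq)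
    then have "N \<bullet> tgt (edge 1) = sin (len (edge 1)) * T"
      by (simp add: tgt_def inner_arc_pt_src_zero N_def T_def vertex_turn_def turn_eq_arc_normal)
    moreover have "0 < sin (len (edge 1))"
      using short[of 1] is_garc_len(1)[OF is_garc_edge] by (intro sin_gt_zero)
    moreover have "0 < T * T"
      using vertex_turn_nonzero[of 0] by (auto simp: T_def zero_less_mult_iff linorder_neq_iff)
    ultimately show ?case using tgt_edge_eq[of 1]
      by (auto simp: numeral_2_eq_2 zero_less_mult_iff mult_less_0_iff)
  next
    case (Suc k)
    have IH: "0 < T * (-1) ^ k * (N \<bullet> src (edge (k + 2)))" using Suc by simp
    obtain x where x: "x \<in> arc_interior (edge 0)" "x \<in> arc_interior (edge (k + 2))"
      using edges_cross[of "k + 2" 0] Suc.prems by (auto simp: arcs_cross_def)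
    have "N \<bullet> src (edge (k + 2)) \<noteq> 0" using IH by auto
    moreover have "N \<bullet> x = 0" using x(1) by (auto simp: arc_interior_def N_def)
    ultimately have "(N \<bullet> src (edge (k + 2))) * (N \<bullet> src (edge (Suc k + 2))) < 0"
      using short_arc_changes_side[OF short x(2), of N] tgt_edge_eq[of "k + 2"] by simp
    then show ?case
      using IH by (auto simp: zero_less_mult_iff mult_less_0_iff)
  qed
  \<comment> \<open>The number of flips from vertex 2 to vertex \<open>n - 1\<close>.\<close>
  have odd: "odd (n - 3)" using \<open>even n\<close> n by simp
  have last: "edge (Suc (n - 1)) = edge 0" using edge_mod[of n] edge_mod[of 0] n by simp
  \<comment> \<open>The last edge ends on the circle of edge 0. Being short, it starts on the side
    given by the turn at vertex 0, whose sign is that of \<open>T\<close>.\<close>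
  have "N \<bullet> tgt (edge (n - 1)) = 0"
    using tgt_edge_eq[of "n - 1"] last by (simp add: N_def)
  then have "N \<bullet> src (edge (n - 1)) =
      - (sin (len (edge (n - 1))) * (N \<bullet> arc_vel (edge (n - 1)) (len (edge (n - 1)))))"
    using inner_arc_pt_zero[of N "edge (n - 1)" "len (edge (n - 1))" 0] by (simp add: tgt_def)
  also have "\<dots> = sin (len (edge (n - 1))) * vertex_turn (n - 1)"
    using turn_eq_neg_arc_normal[OF tgt_edge_eq[of "n - 1"]] unfolding vertex_turn_def last
    by (simp add: N_def)
  finally have "sgn (N \<bullet> src (edge (n - 1))) = sgn T"
    using short[of "n - 1"] is_garc_len(1)[OF is_garc_edge] sin_gt_zero[of "len (edge (n - 1))"]
      sgn_vertex_turn[of "n - 1"]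
    by (simp add: sgn_mult T_def)
  moreover have "T * (N \<bullet> src (edge (n - 1))) < 0"
  proof -
    have "n - 3 + 2 = n - 1" using n by simp
    then show ?thesis using side[of "n - 3"] odd n by simp
  qed
  ultimately show False
    by (auto simp: sgn_if mult_less_0_iff split: if_splits)
qed

lemma even_imp_long_arc:
  assumes "even n"
  shows "\<exists>x y. {x, y} \<in> cycle_edges n \<and> long_arc (A x y)"
proof -
  obtain i where "pi \<le> len (edge i)"
    using odd_if_all_short assms by (metis not_le)
  moreover have "len (edge i) \<noteq> pi"
    using general cycle_edges_Suc[of i] unfolding general_position_def edge_def by blast
  ultimately have "long_arc (A (i mod n) (Suc i mod n))"
    by (simp add: long_arc_def edge_def)
  then show ?thesis using cycle_edges_Suc by blast
qed

end

theorem theorem3p1: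
  fixes n :: nat and pos :: "nat \<Rightarrow> real^3" and A :: "nat \<Rightarrow> nat \<Rightarrow> garc"
  assumes "n \<ge> 5"
    and "spherical_thrackle (cycle_verts n) (cycle_edges n) pos A"
    and "general_position (cycle_edges n) A"
  shows "good_cycle (cycle_edges n) A \<and>
    (even n \<longrightarrow> (\<exists>x y. {x, y} \<in> cycle_edges n \<and> long_arc (A x y)))"
proof -
  interpret cycle_thrackle n pos A
    using assms by unfold_locales
  show ?thesis using good_cycle even_imp_long_arc by blast
qed

end
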